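(* Let $n\ge 1$ and $k\ge 0$ be integers. Then $$\left\langle {n\atop k}\right\rangle_B=\sum_{i=0}^{2k}\left\langle {n\atop i}\right\rangle\binom{n+1}{2k-i}\qquad\text{and}\qquad 2^n\left\langle {n\atop k}\right\rangle=\sum_{i=0}^{2k+1}\left\langle {n\atop i}\right\rangle\binom{n+1}{2k+1-i}.$$
   Context: For $n\ge1$ let $[n]=\{1,\dots,n\}$ and let $S_n$ be the set of permutations $w=w_1w_2\cdots w_n$ of $[n]$. The number of descents of $w\in S_n$ is $\mathrm{des}(w)=|\{i\in\{1,\dots,n-1\}: w_i>w_{i+1}\}|$, and the Eulerian number of type $A$ is $\left\langle {n\atop k}\right\rangle=|\{w\in S_n:\mathrm{des}(w)=k\}|$ (so it is $0$ if $k\ge n$). A signed permutation of $[n]$ is a permutation $u$ of $\{-n,\dots,-1,1,\dots,n\}$ with $u_{-i}=-u_i$ for all $i$; $B_n$ is the set of signed permutations of $[n]$. With the convention $u_0=0$, $\mathrm{des}_B(u)=|\{i\in\{0,1,\dots,n-1\}:u_i>u_{i+1}\}|$, and the Eulerian number of type $B$ is $\left\langle {n\atop k}\right\rangle_B=|\{u\in B_n:\mathrm{des}_B(u)=k\}|$. Binomial coefficients $\binom{a}{b}$ with $b>a\geq 0$ are $0$. *)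

theory Defs
  imports "HOL-Combinatorics.Permutations"
begin

definition des :: "nat \<Rightarrow> (nat \<Rightarrow> nat) \<Rightarrow> nat" where
  "des n w = card {i \<in> {1..<n}. w i > w (i + 1)}"

definition eulerian :: "nat \<Rightarrow> nat \<Rightarrow> nat" where
  "eulerian n k = card {w. w permutes {1..n} \<and> des n w = k}"

definition signed_permutations :: "nat \<Rightarrow> (int \<Rightarrow> int) set" where
  "signed_permutations n =
     {u. u permutes ({- int n..int n} - {0}) \<and> (\<forall>i \<in> {- int n..int n} - {0}. u (- i) = - u i)}"

(* The convention u 0 = 0 is built in: permutes forces u to fix every point outside its carrier. *)
definition desB :: "nat \<Rightarrow> (int \<Rightarrow> int) \<Rightarrow> nat" where
  "desB n u = card {i \<in> {0..<int n}. u i > u (i + 1)}"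

definition eulerianB :: "nat \<Rightarrow> nat \<Rightarrow> nat" where
  "eulerianB n k = card {u \<in> signed_permutations n. desB n u = k}"

lemma signed_permutations_0: "u \<in> signed_permutations n \<Longrightarrow> u 0 = 0"
  unfolding signed_permutations_def by (auto intro: permutes_not_in)

lemma finite_signed_permutations: "finite (signed_permutations n)"
  unfolding signed_permutations_def
  by (rule finite_subset[OF _ finite_permutations[of "{- int n..int n} - {0}"]]) auto

end

(* Sorting the values of a function stably (i.e. sorting by the key (f x, x)) assigns to every
   f : [n] -> {0..m} a permutation w; the functions sorted by w become weakly increasing sequences
   that increase strictly at the descents of w, and there are binom(m - des w + n, n) of those.
   This gives Worpitzky's identity for (m+1)^n.  Replacing f by an odd function
   {-n..n} -> {-m..m}, the sorting permutation is automatically a signed permutation and the same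
   count gives (2m+1)^n in terms of des_B.  Hence, with A and B the Eulerian polynomials,
   A(t) = (1-t)^(n+1) sum (m+1)^n t^m and B(t) = (1-t)^(n+1) sum (2m+1)^n t^m, and splitting
   (1+t)^(n+1) A(t) = (1-t^2)^(n+1) sum (m+1)^n t^m into even and odd powers of t yields
   B(t^2) + 2^n t A(t^2). *)

theory Submission
  imports
    Defs
    "HOL-Library.Product_Lexorder"
    "HOL-Computational_Algebra.Computational_Algebra"
begin

section \<open>Sorting permutations\<close>

text \<open>The rank of a key among all keys and the position of an index in \<open>S\<close> are
  both bijections from \<open>S\<close> onto the same initial segment. Sorting means matching rank
  with position, which leaves exactly one choice. The abstract index order covers both {1..n} and
  the symmetric interval {-n..n}.\<close>

lemma ex1_sorting_permutation:
  fixes K :: "'a::linorder \<Rightarrow> 'b::linorder"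
  assumes fin: "finite S" and inj: "inj_on K S"
  shows "\<exists>!w. w permutes S \<and> strict_mono_on S (K \<circ> w)"
proof -
  define rk where "rk x = card {y \<in> S. K y < K x}" for x
  define pos where "pos i = card {j \<in> S. j < i}" for i
  have rk_less: "rk x < rk y" if "x \<in> S" "K x < K y" for x y
    unfolding rk_def using that fin by (intro psubset_card_mono) auto
  have pos_less: "pos x < pos y" if "x \<in> S" "x < y" for x y
    unfolding pos_def using that fin by (intro psubset_card_mono) auto
  have inj_rk: "inj_on rk S"
    by (rule inj_onI) (metis inj inj_on_eq_iff less_irrefl linorder_neqE rk_less)
  have inj_pos: "inj_on pos S"
    by (rule inj_onI) (metis less_irrefl linorder_neqE pos_less)
  have "rk ` S \<subseteq> {..<card S}" "pos ` S \<subseteq> {..<card S}"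
    unfolding rk_def pos_def using fin by (auto intro!: psubset_card_mono)
  then have ran_rk: "rk ` S = {..<card S}" and ran_pos: "pos ` S = {..<card S}"
    by (simp_all add: card_image card_subset_eq inj_rk inj_pos)
  have sorts_iff: "strict_mono_on S (K \<circ> w) \<longleftrightarrow> (\<forall>i\<in>S. rk (w i) = pos i)"
    if w: "w permutes S" for w
  proof
    assume mono: "strict_mono_on S (K \<circ> w)"
    show "\<forall>i\<in>S. rk (w i) = pos i"
    proof
      fix i assume i: "i \<in> S"
      \<comment> \<open>In a sorted arrangement the smaller keys are exactly those placed earlier;
        taking cardinalities of both sides turns this into rank = position.\<close>
      have "{y \<in> S. K y < K (w i)} = w ` {j \<in> S. j < i}"
      proof (intro equalityI subsetI)
        fix y assume y: "y \<in> {y \<in> S. K y < K (w i)}"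
        then obtain j where j: "j \<in> S" "y = w j"
          using permutes_image[OF w] by blast
        have "j < i"
        proof (rule ccontr)
          assume "\<not> j < i"
          then have "i = j \<or> i < j" by auto
          then show False
            using strict_mono_onD[OF mono, of i j] y j i by auto
        qed
        then show "y \<in> w ` {j \<in> S. j < i}" using j by blast
      next
        fix y assume "y \<in> w ` {j \<in> S. j < i}"
        then show "y \<in> {y \<in> S. K y < K (w i)}"
          using strict_mono_onD[OF mono] i permutes_in_image[OF w] by auto
      qed
      then show "rk (w i) = pos i"
        unfolding rk_def pos_def
        using card_image[OF inj_on_subset[OF permutes_inj[OF w] subset_UNIV]] by metis
    qed
  next
    assume eq: "\<forall>i\<in>S. rk (w i) = pos i"
    show "strict_mono_on S (K \<circ> w)"
    proof (rule strict_mono_onI)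
      fix i j assume ij: "i \<in> S" "j \<in> S" "i < j"
      then have less: "rk (w i) < rk (w j)" using eq pos_less by simp
      have "w i \<in> S" "w j \<in> S" using ij permutes_in_image[OF w] by auto
      then show "(K \<circ> w) i < (K \<circ> w) j"
        using less rk_less by (metis comp_apply less_asym linorder_neqE less_irrefl inj inj_on_eq_iff)
    qed
  qed
  \<comment> \<open>The element put at \<open>i\<close> is the one whose rank is the position of
    \<open>i\<close>; the identity outside \<open>S\<close> is what \<open>permutes\<close>
    requires.\<close>
  define v where "v i = (if i \<in> S then inv_into S rk (pos i) else i)" for i
  have v: "v permutes S"
  proof (rule bij_imp_permutes)
    have "bij_betw (inv_into S rk \<circ> pos) S S"
      using inj_rk ran_rk inj_pos ran_pos
      by (intro bij_betw_trans[of _ _ "{..<card S}"] bij_betw_inv_into) (auto simp: bij_betw_def)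
    moreover have "bij_betw v S S \<longleftrightarrow> bij_betw (inv_into S rk \<circ> pos) S S"
      by (rule bij_betw_cong) (simp add: v_def)
    ultimately show "bij_betw v S S" by blast
  qed (simp add: v_def)
  have rk_v: "\<forall>i\<in>S. rk (v i) = pos i"
    using ran_rk ran_pos by (auto simp: v_def intro!: f_inv_into_f)
  show ?thesis
  proof (rule ex1I[of _ v])
    show "v permutes S \<and> strict_mono_on S (K \<circ> v)"
      using v rk_v sorts_iff by blast
    fix w assume w: "w permutes S \<and> strict_mono_on S (K \<circ> w)"
    show "w = v"
    proof
      fix i
      show "w i = v i"
      proof (cases "i \<in> S")
        case True
        then have "rk (w i) = rk (v i)" using w sorts_iff rk_v by metis
        then show ?thesis
          using True inj_rk w v by (meson inj_on_eq_iff permutes_in_image)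
      next
        case False
        then show ?thesis using w v by (metis permutes_not_in)
      qed
    qed
  qed
qed

lemma strict_chain_less:
  fixes h :: "nat \<Rightarrow> 'a::order"
  assumes "\<And>i. i < n \<Longrightarrow> h i < h (Suc i)" and "i < j" and "j \<le> n"
  shows "h i < h j"
  using \<open>i < j\<close> \<open>j \<le> n\<close>
proof (induction j)
  case (Suc j)
  then show ?case
    using assms(1)[of j] by (cases "i = j") (auto intro: less_trans)
qed simp

section \<open>Counting weakly increasing sequences with prescribed strict steps\<close>

text \<open>The entry at 0 is pinned to 0, so a member of \<open>D\<close> at 0 forces a positive
  first entry; this is how a type B descent at 0 will enter. The value 0 beyond \<open>n\<close>
  makes each finite sequence correspond to a single function.\<close>

definition step_seqs :: "nat \<Rightarrow> nat set \<Rightarrow> nat \<Rightarrow> (nat \<Rightarrow> nat) set" where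
  "step_seqs n D m = {g. g 0 = 0 \<and> (\<forall>i<n. g i + of_bool (i \<in> D) \<le> g (Suc i))
     \<and> g n \<le> m \<and> (\<forall>i>n. g i = 0)}"

lemma step_seqs_mono:
  assumes "g \<in> step_seqs n D m" "i \<le> j" "j \<le> n"
  shows "g i \<le> g j"
  using assms(2,3)
proof (induction j)
  case (Suc j)
  have "g j + of_bool (j \<in> D) \<le> g (Suc j)"
    using assms(1) Suc.prems by (simp add: step_seqs_def)
  then have "g j \<le> g (Suc j)" by simp
  then show ?case using Suc by (cases "i = Suc j") auto
qed simp

lemma step_seqs_0: "step_seqs 0 D m = {\<lambda>_. 0}"
proof (intro equalityI subsetI)
  fix g assume "g \<in> step_seqs 0 D m"
  then have "g i = 0" for i by (cases "i = 0") (auto simp: step_seqs_def)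
  then show "g \<in> {\<lambda>_. 0}" by auto
qed (simp add: step_seqs_def)

lemma finite_step_seqs: "finite (step_seqs n D m)"
proof (rule finite_subset)
  show "step_seqs n D m \<subseteq> {g. \<forall>i. (i \<in> {..n} \<longrightarrow> g i \<in> {..m}) \<and> (i \<notin> {..n} \<longrightarrow> g i = 0)}"
  proof (intro subsetI CollectI allI)
    fix g i assume g: "g \<in> step_seqs n D m"
    have "g i \<le> m" if "i \<le> n"
      using step_seqs_mono[OF g that order_refl] g by (simp add: step_seqs_def)
    then show "(i \<in> {..n} \<longrightarrow> g i \<in> {..m}) \<and> (i \<notin> {..n} \<longrightarrow> g i = 0)"
      using g by (simp add: step_seqs_def)
  qed
  show "finite {g. \<forall>i. (i \<in> {..n} \<longrightarrow> g i \<in> {..m}) \<and> (i \<notin> {..n} \<longrightarrow> g i = (0::nat))}"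
    by (rule finite_set_of_finite_funs) auto
qed

text \<open>Erasing the final entry \<open>m\<close> leaves a shorter sequence bounded by
  \<open>m\<close>, or by \<open>m - 1\<close> if the last step is strict. The guard catches a
  strict step into \<open>m = 0\<close>, which truncated subtraction would hide.\<close>

lemma card_step_seqs_last:
  "card {g \<in> step_seqs (Suc n) D m. g (Suc n) = m} =
     (if of_bool (n \<in> D) \<le> m then card (step_seqs n D (m - of_bool (n \<in> D))) else 0)"
proof (cases "of_bool (n \<in> D) \<le> m")
  case True
  have "bij_betw (\<lambda>g. g(Suc n := 0)) {g \<in> step_seqs (Suc n) D m. g (Suc n) = m}
          (step_seqs n D (m - of_bool (n \<in> D)))"
    by (rule bij_betwI[where g = "\<lambda>g. g(Suc n := m)"])
      (use True in \<open>simp_all add: Pi_iff step_seqs_def fun_eq_iff All_less_Suc le_diff_conv2\<close>)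
  then show ?thesis using True by (simp add: bij_betw_same_card)
next
  case False
  then have empty: "{g \<in> step_seqs (Suc n) D m. g (Suc n) = m} = {}"
    by (auto simp: step_seqs_def)
  show ?thesis unfolding empty using False by simp
qed

lemma step_seqs_Suc_bound:
  "step_seqs n D (Suc m) = {g \<in> step_seqs n D (Suc m). g n = Suc m} \<union> step_seqs n D m"
  by (auto simp: step_seqs_def)

lemma card_Int_lessThan_Suc:
  "card (D \<inter> {..<Suc n}) = card (D \<inter> {..<n}) + of_bool (n \<in> D)"
  by (simp add: lessThan_Suc)

text \<open>Only the number of strict steps matters. Splitting on whether the last entry attains the
  bound gives Pascal's recurrence. The induction on \<open>n\<close> keeps the bound arbitrary
  because erasing a strict last step lowers it by one.\<close>

lemma card_step_seqs:
  "card (step_seqs n D m) =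
     (if card (D \<inter> {..<n}) \<le> m then (m - card (D \<inter> {..<n}) + n) choose n else 0)"
proof (induction n arbitrary: m)
  case 0
  then show ?case by (simp add: step_seqs_0)
next
  case (Suc n)
  note IH = Suc.IH
  let ?d = "card (D \<inter> {..<n})" and ?e = "of_bool (n \<in> D) :: nat"
  show ?case
  proof (induction m)
    case 0
    have "step_seqs (Suc n) D 0 = {g \<in> step_seqs (Suc n) D 0. g (Suc n) = 0}"
      by (auto simp: step_seqs_def)
    then have "card (step_seqs (Suc n) D 0) = (if ?e \<le> 0 then card (step_seqs n D (0 - ?e)) else 0)"
      using card_step_seqs_last[of n D 0] by metis
    then show ?case using Suc.IH by (auto simp: card_Int_lessThan_Suc)
  next
    case (Suc m)
    have "card (step_seqs (Suc n) D (Suc m)) =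
        card {g \<in> step_seqs (Suc n) D (Suc m). g (Suc n) = Suc m} + card (step_seqs (Suc n) D m)"
      by (subst step_seqs_Suc_bound, rule card_Un_disjoint)
        (simp_all add: finite_step_seqs, auto simp: step_seqs_def)
    also have "\<dots> = card (step_seqs n D (Suc m - ?e)) + card (step_seqs (Suc n) D m)"
      by (simp add: card_step_seqs_last)
    also have "\<dots> = (if ?d + ?e \<le> Suc m then (Suc m - (?d + ?e) + Suc n) choose Suc n else 0)"
    proof -
      \<comment> \<open>Pascal's rule applies in the first case. At the boundary the first summand
        is 1 and the second 0, and above it both vanish.\<close>
      consider "?d + ?e \<le> m" | "?d + ?e = Suc m" | "?d + ?e > Suc m" by linarith
      then show ?thesis
      proof cases
        case 1
        then have "Suc m - (?d + ?e) = Suc (m - (?d + ?e))" "Suc m - ?e - ?d = Suc (m - (?d + ?e))"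
          by auto
        then show ?thesis
          using 1 Suc.IH IH
          by (simp add: card_Int_lessThan_Suc)
      next
        case 2
        then show ?thesis
          using Suc.IH IH
          by (auto simp: card_Int_lessThan_Suc)
      next
        case 3
        then show ?thesis
          using Suc.IH IH
          by (auto simp: card_Int_lessThan_Suc split: if_splits)
      qed
    qed
    finally show ?case by (simp add: card_Int_lessThan_Suc)
  qed
qed

text \<open>Double counting of the pairs related by \<open>P\<close>: each \<open>f\<close> lies in
  one pair, while the number of pairs containing \<open>w\<close> depends only on
  \<open>stat w\<close>. Both Worpitzky identities are instances.\<close>

lemma card_eq_sum_by_statistic:
  fixes P :: "'f \<Rightarrow> 'w \<Rightarrow> bool" and stat :: "'w \<Rightarrow> nat"
  assumes fin: "finite F" "finite W"
    and unique: "\<And>f. f \<in> F \<Longrightarrow> \<exists>!w. w \<in> W \<and> P f w"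
    and fibre: "\<And>w. w \<in> W \<Longrightarrow> card {f \<in> F. P f w} =
      (if stat w \<le> m then (m - stat w + n) choose n else 0)"
  shows "card F = (\<Sum>k\<le>m. card {w \<in> W. stat w = k} * ((m - k + n) choose n))"
proof -
  have "card {w \<in> W. P f w} = 1" if f: "f \<in> F" for f
  proof -
    obtain w where "w \<in> W \<and> P f w" "\<And>v. v \<in> W \<and> P f v \<Longrightarrow> v = w"
      using unique[OF f] by blast
    then have "{w \<in> W. P f w} = {w}" by blast
    then show ?thesis by simp
  qed
  then have "card F = (\<Sum>f\<in>F. \<Sum>w\<in>{w \<in> W. P f w}. 1)"
    by simp
  also have "\<dots> = (\<Sum>w\<in>W. \<Sum>f\<in>{f \<in> F. P f w}. 1)"
    by (rule sum.swap_restrict[OF fin])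
  also have "\<dots> = (\<Sum>w\<in>W. card {f \<in> F. P f w})"
    by simp
  also have "\<dots> = (\<Sum>w\<in>W. \<Sum>k\<in>{k \<in> {..m}. stat w = k}. (m - k + n) choose n)"
  proof (rule sum.cong)
    fix w assume w: "w \<in> W"
    \<comment> \<open>An index set with at most one element turns the guarded binomial coefficient
      into a sum over \<open>k\<close>, so that the order of summation can be exchanged.\<close>
    have "{k \<in> {..m}. stat w = k} = (if stat w \<le> m then {stat w} else {})" by auto
    then show "card {f \<in> F. P f w} = (\<Sum>k\<in>{k \<in> {..m}. stat w = k}. (m - k + n) choose n)"
      using fibre[OF w] by simp
  qed simp
  also have "\<dots> = (\<Sum>k\<le>m. \<Sum>w\<in>{w \<in> W. stat w = k}. (m - k + n) choose n)"
    by (rule sum.swap_restrict) (use fin in auto)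
  finally show ?thesis by simp
qed

section \<open>Worpitzky identities\<close>

lemma card_functions_with_default:
  assumes "finite A"
  shows "card {f. \<forall>x. (x \<in> A \<longrightarrow> f x \<in> B) \<and> (x \<notin> A \<longrightarrow> f x = d)} = card B ^ card A"
proof -
  have "bij_betw (\<lambda>f. restrict f A) {f. \<forall>x. (x \<in> A \<longrightarrow> f x \<in> B) \<and> (x \<notin> A \<longrightarrow> f x = d)} (A \<rightarrow>\<^sub>E B)"
    by (rule bij_betwI[where g = "\<lambda>f x. if x \<in> A then f x else d"])
      (auto simp: fun_eq_iff PiE_def extensional_def)
  then show ?thesis
    using assms by (simp add: bij_betw_same_card card_funcsetE)
qed

text \<open>Each of the (m+1)^n functions in \<open>F\<close> is sorted by a unique
  \<open>w\<close>. Those sorted by a given \<open>w\<close> correspond, via \<open>f\<close> to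
  \<open>f \<circ> w\<close>, to the step sequences with strict steps at the descents of
  \<open>w\<close>.\<close>

lemma worpitzky_eulerian:
  "(m + 1) ^ n = (\<Sum>k\<le>m. eulerian n k * ((m - k + n) choose n))"
proof -
  define F :: "(nat \<Rightarrow> nat) set"
    where "F = {f. \<forall>x. (x \<in> {1..n} \<longrightarrow> f x \<in> {..m}) \<and> (x \<notin> {1..n} \<longrightarrow> f x = 0)}"
  define W where "W = {w. w permutes {1..n}}"
  \<comment> \<open>The chain starts at index 0 to match \<open>step_seqs\<close>. For
    \<open>f\<close> in \<open>F\<close> and \<open>w\<close> in \<open>W\<close> the initial pair
    is (0, 0), so the first comparison holds automatically.\<close>
  define P where "P f w \<longleftrightarrow> (\<forall>i<n. (f (w i), w i) < (f (w (Suc i)), w (Suc i)))"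
    for f w :: "nat \<Rightarrow> nat"
  have F_bound: "f x \<le> m" if "f \<in> F" for f x
    using that by (cases "x \<in> {1..n}") (auto simp: F_def)
  have F_0: "f 0 = 0" if "f \<in> F" for f
    using that by (auto simp: F_def)
  have W_0: "w 0 = 0" if "w \<in> W" for w
    using that permutes_not_in[of w "{1..n}" 0] by (simp add: W_def)
  have "card F = (m + 1) ^ n"
    unfolding F_def by (subst card_functions_with_default) auto
  moreover have "card F = (\<Sum>k\<le>m. card {w \<in> W. des n w = k} * ((m - k + n) choose n))"
  proof (rule card_eq_sum_by_statistic[where P = P])
    show "finite F"
      unfolding F_def by (rule finite_set_of_finite_funs) auto
    show "finite W"
      unfolding W_def by (rule finite_permutations) auto
  next
    fix f assume f: "f \<in> F"
    have "P f w \<longleftrightarrow> strict_mono_on {1..n} ((\<lambda>x. (f x, x)) \<circ> w)" if w: "w \<in> W" for w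
    proof
      assume "P f w"
      then show "strict_mono_on {1..n} ((\<lambda>x. (f x, x)) \<circ> w)"
        unfolding P_def
        by (intro strict_mono_onI) (use strict_chain_less[of n "\<lambda>i. (f (w i), w i)"] in auto)
    next
      assume mono: "strict_mono_on {1..n} ((\<lambda>x. (f x, x)) \<circ> w)"
      show "P f w"
        unfolding P_def
      proof (intro allI impI)
        fix i assume i: "i < n"
        show "(f (w i), w i) < (f (w (Suc i)), w (Suc i))"
        proof (cases "i = 0")
          case True
          have "w (Suc 0) \<in> {1..n}"
            using w i True permutes_in_image[of w "{1..n}" "Suc 0"] by (simp add: W_def)
          then show ?thesis using True W_0[OF w] F_0[OF f] by auto
        next
          case False
          then show ?thesis using strict_mono_onD[OF mono, of i "Suc i"] i by simp
        qed
      qed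
    qed
    moreover have "\<exists>!w. w permutes {1..n} \<and> strict_mono_on {1..n} ((\<lambda>x. (f x, x)) \<circ> w)"
      by (rule ex1_sorting_permutation) (auto simp: inj_on_def)
    ultimately show "\<exists>!w. w \<in> W \<and> P f w"
      unfolding W_def mem_Collect_eq by metis
  next
    fix w assume w: "w \<in> W"
    then have perm: "w permutes {1..n}" by (simp add: W_def)
    define D where "D = {i. w i > w (Suc i)}"
    \<comment> \<open>Index 0 is never in \<open>D\<close> here because \<open>w 0 = 0\<close> is
      the least natural number.\<close>
    have "D \<inter> {..<n} = {i \<in> {1..<n}. w i > w (i + 1)}"
      using W_0[OF w] by (auto simp: D_def Suc_le_eq intro: gr0I)
    then have card_D: "card (D \<inter> {..<n}) = des n w"
      by (simp add: des_def)
    \<comment> \<open>By injectivity the second components differ, so they decide a tie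
      \<open>a = b\<close>: it is allowed at an ascent and forbidden at a descent.\<close>
    have step: "a + of_bool (i \<in> D) \<le> b \<longleftrightarrow> (a, w i) < (b, w (Suc i))" for a b i :: nat
    proof -
      have "w i \<noteq> w (Suc i)" using injD[OF permutes_inj[OF perm], of i "Suc i"] by auto
      then show ?thesis by (auto simp: D_def)
    qed
    have "bij_betw (\<lambda>f. f \<circ> w) {f \<in> F. P f w} (step_seqs n D m)"
    proof (rule bij_betwI[where g = "\<lambda>g. g \<circ> inv w"])
      show "(\<lambda>f. f \<circ> w) \<in> {f \<in> F. P f w} \<rightarrow> step_seqs n D m"
      proof
        fix f assume "f \<in> {f \<in> F. P f w}"
        then have f: "f \<in> F" "P f w" by auto
        have "(f \<circ> w) i + of_bool (i \<in> D) \<le> (f \<circ> w) (Suc i)" if "i < n" for i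
          using f(2) that unfolding step P_def comp_apply by blast
        moreover have "(f \<circ> w) i = 0" if "i > n" for i
          using permutes_not_in[OF perm, of i] f(1) that by (simp add: F_def)
        ultimately show "f \<circ> w \<in> step_seqs n D m"
          using F_0[OF f(1)] F_bound[OF f(1)] W_0[OF w] by (simp add: step_seqs_def)
      qed
      show "(\<lambda>g. g \<circ> inv w) \<in> step_seqs n D m \<rightarrow> {f \<in> F. P f w}"
      proof
        fix g assume g: "g \<in> step_seqs n D m"
        have "P (g \<circ> inv w) w"
          using g permutes_inverses[OF perm] by (simp add: P_def step_seqs_def step)
        moreover have "g \<circ> inv w \<in> F"
          unfolding F_def
        proof (intro CollectI allI conjI impI)
          fix x assume "x \<in> {1..n}"
          then have "inv w x \<in> {1..n}"
            using permutes_in_image[OF permutes_inv[OF perm]] by blast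
          then show "(g \<circ> inv w) x \<in> {..m}"
            using step_seqs_mono[OF g, of "inv w x" n] g by (auto simp: step_seqs_def)
        next
          fix x assume "x \<notin> {1..n}"
          then show "(g \<circ> inv w) x = 0"
            using permutes_not_in[OF permutes_inv[OF perm]] g
            by (cases "x = 0") (auto simp: step_seqs_def)
        qed
        ultimately show "g \<circ> inv w \<in> {f \<in> F. P f w}" by simp
      qed
    qed (simp_all add: fun_eq_iff permutes_inverses[OF perm])
    then have "card {f \<in> F. P f w} = card (step_seqs n D m)"
      by (rule bij_betw_same_card)
    then show "card {f \<in> F. P f w} = (if des n w \<le> m then (m - des n w + n) choose n else 0)"
      by (simp add: card_step_seqs card_D)
  qed
  moreover have "card {w \<in> W. des n w = k} = eulerian n k" for k
    by (simp add: W_def eulerian_def)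
  ultimately show ?thesis by simp
qed

section \<open>Type B: signed permutations and odd functions\<close>

lemma signed_permutations_minus:
  assumes "u \<in> signed_permutations n"
  shows "u (- x) = - u x"
proof (cases "x \<in> {- int n..int n} - {0}")
  case True
  then show ?thesis using assms unfolding signed_permutations_def by blast
next
  case False
  have u: "u permutes ({- int n..int n} - {0})"
    using assms unfolding signed_permutations_def by blast
  \<comment> \<open>The carrier is symmetric, so \<open>u\<close> fixes both \<open>x\<close> and
    \<open>- x\<close>; the case \<open>x = 0\<close> is included.\<close>
  have "- x \<notin> {- int n..int n} - {0}" using False by auto
  then show ?thesis
    unfolding permutes_not_in[OF u False] by (rule permutes_not_in[OF u])
qed

lemma signed_permutations_permutes:
  "u \<in> signed_permutations n \<Longrightarrow> u permutes {- int n..int n}"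
  unfolding signed_permutations_def by (elim CollectE conjE permutes_subset) blast

lemma permutes_odd_imp_signed_permutations:
  assumes "w permutes {- int n..int n}" and odd: "\<And>x. w (- x) = - w x"
  shows "w \<in> signed_permutations n"
proof -
  have "w 0 = 0" using odd[of 0] by simp
  then have "w permutes ({- int n..int n} - {0})"
    by (intro permutes_superset[OF assms(1)]) auto
  then show ?thesis using odd by (simp add: signed_permutations_def)
qed

text \<open>A sorted odd arrangement is determined by its half over 0..n, so the functions sorted by
  \<open>u\<close> again form a set of step sequences. Now 0 may belong to \<open>D\<close>, namely
  when \<open>u 1\<close> is negative, and this is the additional descent counted by
  \<open>desB\<close>.\<close>

lemma worpitzky_eulerianB:
  "(2 * m + 1) ^ n = (\<Sum>k\<le>m. eulerianB n k * ((m - k + n) choose n))"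
proof -
  \<comment> \<open>Zero is included so that the sorted chain passes through the centre of symmetry,
    where \<open>u\<close> and \<open>f\<close> both vanish.\<close>
  define S where "S = {- int n..int n}"
  define F :: "(int \<Rightarrow> int) set"
    where "F = {f. \<forall>x. f (- x) = - f x \<and> \<bar>f x\<bar> \<le> int m \<and> (x \<notin> S \<longrightarrow> f x = 0)}"
  define W where "W = signed_permutations n"
  define P where "P f u \<longleftrightarrow>
      (\<forall>i<n. (f (u (int i)), u (int i)) < (f (u (int (Suc i))), u (int (Suc i))))"
    for f u :: "int \<Rightarrow> int"
  define F' :: "(int \<Rightarrow> int) set"
    where "F' = {f. \<forall>x. (x \<in> {1..int n} \<longrightarrow> f x \<in> {- int m..int m}) \<and> (x \<notin> {1..int n} \<longrightarrow> f x = 0)}"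
  have F_0: "f 0 = 0" if "f \<in> F" for f
  proof -
    have "f (- 0) = - f 0" using that unfolding F_def by blast
    then show ?thesis by simp
  qed
  have F_minus: "f (- x) = - f x" if "f \<in> F" for f x
    using that by (simp add: F_def)
  have bij_F: "bij_betw (\<lambda>f x. if 0 < x then f x else 0) F F'"
  \<comment> \<open>The inverse is odd extension: \<open>h\<close> is supported on positive
    arguments, so at most one of the two terms is nonzero.\<close>
  proof (rule bij_betwI[where g = "\<lambda>h x. h x - h (- x)"])
    show "(\<lambda>f x. if 0 < x then f x else 0) \<in> F \<rightarrow> F'"
      by (auto simp: F_def F'_def S_def abs_le_iff) (smt (verit))+
    show "(\<lambda>h x. h x - h (- x)) \<in> F' \<rightarrow> F"
    proof
      fix h assume "h \<in> F'"
      then have h_le: "x \<in> {1..int n} \<Longrightarrow> h x \<in> {- int m..int m}"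
        and h_0: "x \<notin> {1..int n} \<Longrightarrow> h x = 0" for x
        unfolding F'_def by blast+
      have "\<bar>h x - h (- x)\<bar> \<le> int m" for x
      proof -
        have "h x = 0 \<or> h (- x) = 0" using h_0[of x] h_0[of "- x"] by (cases "0 < x") auto
        moreover have "\<bar>h y\<bar> \<le> int m" for y
          using h_le[of y] h_0[of y] by (cases "y \<in> {1..int n}") auto
        ultimately show ?thesis by (elim disjE) simp_all
      qed
      moreover have "h x - h (- x) = 0" if "x \<notin> S" for x
        using h_0[of x] h_0[of "- x"] that by (auto simp: S_def)
      ultimately show "(\<lambda>x. h x - h (- x)) \<in> F" by (simp add: F_def)
    qed
    show "(\<lambda>x. (if 0 < x then f x else 0) - (if 0 < - x then f (- x) else 0)) = f"
      if "f \<in> F" for f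
      using F_0[OF that] F_minus[OF that] by (auto simp: fun_eq_iff not_less)
    show "(\<lambda>x. if 0 < x then h x - h (- x) else 0) = h" if "h \<in> F'" for h
    proof
      fix x
      show "(if 0 < x then h x - h (- x) else 0) = h x"
        using that by (cases "0 < x") (simp_all add: F'_def)
    qed
  qed
  have "card F = card F'"
    using bij_F by (rule bij_betw_same_card)
  also have "\<dots> = (2 * m + 1) ^ n"
    unfolding F'_def by (subst card_functions_with_default) (auto simp: nat_add_distrib nat_mult_distrib)
  finally have "card F = (2 * m + 1) ^ n" .
  moreover have "card F = (\<Sum>k\<le>m. card {u \<in> W. desB n u = k} * ((m - k + n) choose n))"
  proof (rule card_eq_sum_by_statistic[where P = P])
    have "finite F'"
      unfolding F'_def by (rule finite_set_of_finite_funs) auto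
    then show "finite F"
      using bij_F bij_betw_finite by blast
    show "finite W"
      unfolding W_def by (rule finite_signed_permutations)
  next
    fix f assume f: "f \<in> F"
    let ?K = "\<lambda>x. (f x, x)"
    \<comment> \<open>Since \<open>f\<close> is odd, negating the argument negates both components
      of the key, which reverses the lexicographic order.\<close>
    have K_minus: "?K (- x) < ?K (- y) \<longleftrightarrow> ?K y < ?K x" for x y
      using F_minus[OF f] by auto
    have P_iff: "P f u \<longleftrightarrow> strict_mono_on S (?K \<circ> u)" if u: "u \<in> W" for u
    proof
      assume "P f u"
      then have nat_less: "?K (u (int i)) < ?K (u (int j))" if "i < j" "j \<le> n" for i j
        using strict_chain_less[of n "\<lambda>i. ?K (u (int i))"] that unfolding P_def by blast
      have pos: "?K (u x) < ?K (u y)" if "0 \<le> x" "x < y" "y \<le> int n" for x y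
        using nat_less[of "nat x" "nat y"] that by simp
      \<comment> \<open>The negative half is the mirror image of the positive one; the two are then
        joined through 0.\<close>
      have neg: "?K (u x) < ?K (u y)" if "- int n \<le> x" "x < y" "y \<le> 0" for x y
        using pos[of "- y" "- x"] that signed_permutations_minus[OF u[unfolded W_def]] K_minus
        by simp
      show "strict_mono_on S (?K \<circ> u)"
      proof (rule strict_mono_onI)
        fix x y assume xy: "x \<in> S" "y \<in> S" "x < y"
        consider "0 \<le> x" | "y \<le> 0" | "x < 0" "0 < y" by linarith
        then have "?K (u x) < ?K (u y)"
        proof cases
          case 3
          then show ?thesis
            using less_trans[OF neg[of x 0] pos[of 0 y]] xy by (simp add: S_def)
        qed (use xy pos neg in \<open>auto simp: S_def\<close>)
        then show "(?K \<circ> u) x < (?K \<circ> u) y" by simp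
      qed
    next
      assume mono: "strict_mono_on S (?K \<circ> u)"
      show "P f u"
        unfolding P_def using strict_mono_onD[OF mono] by (auto simp: S_def)
    qed
    obtain w where w: "w permutes S" "strict_mono_on S (?K \<circ> w)"
      and unique: "\<And>v. v permutes S \<Longrightarrow> strict_mono_on S (?K \<circ> v) \<Longrightarrow> v = w"
      using ex1_sorting_permutation[of S ?K] by (auto simp: S_def inj_on_def)
    \<comment> \<open>The conjugate of \<open>w\<close> by negation also sorts \<open>?K\<close>, so uniqueness forces \<open>w\<close> to be odd.\<close>
    have "uminus \<circ> w \<circ> uminus = w"
    proof (rule unique)
      show "uminus \<circ> w \<circ> uminus permutes S"
      proof (rule bij_imp_permutes)
        have "bij_betw uminus S S"
          by (rule bij_betwI[where g = uminus]) (auto simp: S_def)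
        then show "bij_betw (uminus \<circ> w \<circ> uminus) S S"
          using permutes_imp_bij[OF w(1)] by (auto intro: bij_betw_trans)
        show "(uminus \<circ> w \<circ> uminus) x = x" if "x \<notin> S" for x
          using that permutes_not_in[OF w(1), of "- x"] by (auto simp: S_def)
      qed
      show "strict_mono_on S (?K \<circ> (uminus \<circ> w \<circ> uminus))"
      proof (rule strict_mono_onI)
        fix x y assume "x \<in> S" "y \<in> S" "x < y"
        then have "?K (w (- y)) < ?K (w (- x))"
          using strict_mono_onD[OF w(2), of "- y" "- x"] by (simp add: S_def)
        then show "(?K \<circ> (uminus \<circ> w \<circ> uminus)) x < (?K \<circ> (uminus \<circ> w \<circ> uminus)) y"
          using K_minus by simp
      qed
    qed
    then have "w (- x) = - w x" for x
      by (metis comp_apply minus_minus)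
    then have "w \<in> W"
      using w(1) permutes_odd_imp_signed_permutations by (simp add: W_def S_def)
    then show "\<exists>!u. u \<in> W \<and> P f u"
      using w(2) P_iff unique signed_permutations_permutes unfolding W_def S_def by metis
  next
    fix u assume u: "u \<in> W"
    then have perm: "u permutes S"
      by (simp add: W_def S_def signed_permutations_permutes)
    have u_minus: "u (- x) = - u x" for x
      using u signed_permutations_minus by (simp add: W_def)
    have u_0: "u 0 = 0" using u_minus[of 0] by simp
    have inv_minus: "inv u (- x) = - inv u x" for x
      by (metis permutes_inverses[OF perm] u_minus)
    define D where "D = {i. u (int i) > u (int (Suc i))}"
    have "{i \<in> {0..<int n}. u i > u (i + 1)} = int ` (D \<inter> {..<n})"
      by (auto simp: D_def image_iff algebra_simps intro!: bexI[of _ "nat _"])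
    then have card_D: "card (D \<inter> {..<n}) = desB n u"
      by (simp add: desB_def card_image)
    have step: "a + of_bool (i \<in> D) \<le> b \<longleftrightarrow> (a, u (int i)) < (b, u (int (Suc i)))" for a b :: int and i
    proof -
      have "u (int i) \<noteq> u (int (Suc i))"
        using injD[OF permutes_inj[OF perm], of "int i" "int (Suc i)"] by auto
      then show ?thesis by (auto simp: D_def)
    qed
    \<comment> \<open>The chain of pairs increases from (0, 0), so no first component is negative.
      Hence applying \<open>nat\<close> along the chain loses no information.\<close>
    have nonneg: "0 \<le> f (u (int i))" if f: "f \<in> F" "P f u" and i: "i \<le> n" for f i
    proof (cases "i = 0")
      case True
      then show ?thesis using u_0 F_0[OF f(1)] by simp
    next
      case False
      then show ?thesis
        using strict_chain_less[of n "\<lambda>i. (f (u (int i)), u (int i))" 0 i] f i u_0 F_0[OF f(1)]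
        by (auto simp: P_def)
    qed
    \<comment> \<open>Odd extension of a sequence to the integers; \<open>sgn 0 = 0\<close> agrees
      with \<open>g 0 = 0\<close>.\<close>
    define ext where "ext g x = sgn x * int (g (nat \<bar>x\<bar>))" for g and x :: int
    have "bij_betw (\<lambda>f i. nat (f (u (int i)))) {f \<in> F. P f u} (step_seqs n D m)"
    proof (rule bij_betwI[where g = "\<lambda>g. ext g \<circ> inv u"])
      show "(\<lambda>f i. nat (f (u (int i)))) \<in> {f \<in> F. P f u} \<rightarrow> step_seqs n D m"
      proof
        fix f assume "f \<in> {f \<in> F. P f u}"
        then have f: "f \<in> F" "P f u" by auto
        have "nat (f (u (int i))) + of_bool (i \<in> D) \<le> nat (f (u (int (Suc i))))" if "i < n" for i
        proof -
          have "f (u (int i)) + of_bool (i \<in> D) \<le> f (u (int (Suc i)))"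
            using f(2) that unfolding step P_def by blast
          then show ?thesis
            using nonneg[OF f, of i] that by (cases "i \<in> D") auto
        qed
        moreover have "f (u (int i)) = 0" if "i > n" for i
          using permutes_not_in[OF perm, of "int i"] f(1) that by (auto simp: F_def S_def)
        moreover have "f (u (int n)) \<le> int m"
          using f(1) by (auto simp: F_def abs_le_iff)
        ultimately show "(\<lambda>i. nat (f (u (int i)))) \<in> step_seqs n D m"
          using u_0 F_0[OF f(1)] by (simp add: step_seqs_def)
      qed
      show "(\<lambda>g. ext g \<circ> inv u) \<in> step_seqs n D m \<rightarrow> {f \<in> F. P f u}"
      proof
        fix g assume g: "g \<in> step_seqs n D m"
        have g_bound: "g i \<le> m" for i
          using step_seqs_mono[OF g, of i n] g by (cases "i \<le> n") (auto simp: step_seqs_def)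
        have ext_nat: "ext g (int i) = int (g i)" for i
          using g by (cases "i = 0") (auto simp: ext_def step_seqs_def)
        have "P (ext g \<circ> inv u) u"
          unfolding P_def
        proof (intro allI impI)
          fix i assume "i < n"
          then have "int (g i) + of_bool (i \<in> D) \<le> int (g (Suc i))"
            using g by (cases "i \<in> D") (auto simp: step_seqs_def)
          then show "((ext g \<circ> inv u) (u (int i)), u (int i))
              < ((ext g \<circ> inv u) (u (int (Suc i))), u (int (Suc i)))"
            unfolding step comp_apply permutes_inverses[OF perm] ext_nat .
        qed
        moreover have "ext g \<circ> inv u \<in> F"
          unfolding F_def
        proof (intro CollectI allI conjI impI)
          fix x
          show "(ext g \<circ> inv u) (- x) = - (ext g \<circ> inv u) x"
            by (simp add: ext_def inv_minus)
          show "\<bar>(ext g \<circ> inv u) x\<bar> \<le> int m"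
            using g_bound by (simp add: ext_def abs_mult sgn_if)
          assume x: "x \<notin> S"
          then have "inv u x = x"
            using permutes_not_in[OF permutes_inv[OF perm]] by blast
          then show "(ext g \<circ> inv u) x = 0"
            using g x by (auto simp: ext_def step_seqs_def S_def)
        qed
        ultimately show "ext g \<circ> inv u \<in> {f \<in> F. P f u}" by simp
      qed
      show "(\<lambda>i. nat ((ext g \<circ> inv u) (u (int i)))) = g" if "g \<in> step_seqs n D m" for g
        using that by (auto simp: fun_eq_iff permutes_inverses[OF perm] ext_def step_seqs_def sgn_if)
      show "ext (\<lambda>i. nat (f (u (int i)))) \<circ> inv u = f" if "f \<in> {f \<in> F. P f u}" for f
      proof
        fix x
        have f: "f \<in> F" "P f u" using that by auto
        define y where "y = inv u x"
        have x: "x = u y" by (simp add: y_def permutes_inverses[OF perm])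
        have nn: "0 \<le> f (u z)" if "0 \<le> z" for z
        proof (cases "z \<le> int n")
          case True
          then show ?thesis using nonneg[OF f, of "nat z"] that by simp
        next
          case False
          then show ?thesis
            using permutes_not_in[OF perm, of z] f(1) by (auto simp: F_def S_def)
        qed
        have "ext (\<lambda>i. nat (f (u (int i)))) y = f (u y)"
        proof -
          consider "y = 0" | "0 < y" | "y < 0" by linarith
          then show ?thesis
          proof cases
            case 1
            then show ?thesis using u_0 F_0[OF f(1)] by (simp add: ext_def)
          next
            case 2
            then show ?thesis using nn[of y] by (simp add: ext_def)
          next
            case 3
            then show ?thesis
              using nn[of "- y"] u_minus F_minus[OF f(1)] by (simp add: ext_def)
          qed
        qed
        then show "(ext (\<lambda>i. nat (f (u (int i)))) \<circ> inv u) x = f x"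
          by (simp add: y_def[symmetric] x[symmetric])
      qed
    qed
    then have "card {f \<in> F. P f u} = card (step_seqs n D m)"
      by (rule bij_betw_same_card)
    then show "card {f \<in> F. P f u} = (if desB n u \<le> m then (m - desB n u + n) choose n else 0)"
      by (simp add: card_step_seqs card_D)
  qed
  moreover have "card {u \<in> W. desB n u = k} = eulerianB n k" for k
    by (simp add: W_def eulerianB_def)
  ultimately show ?thesis by simp
qed

section \<open>Generating functions\<close>

text \<open>Multiplication by 1 - X takes successive differences of coefficients, and Pascal's rule
  turns those of the binomial sequence for \<open>Suc n\<close> into the sequence for
  \<open>n\<close>. Each induction step absorbs one factor.\<close>

lemma one_minus_X_power_times_binomial_series:
  "(1 - fps_X) ^ Suc n * Abs_fps (\<lambda>m. of_nat ((m + n) choose n)) = (1 :: 'a::comm_ring_1 fps)"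
proof (induction n)
  case 0
  show ?case by (rule fps_ext) (simp add: algebra_simps)
next
  case (Suc n)
  have "(1 - fps_X) * Abs_fps (\<lambda>m. of_nat ((m + Suc n) choose Suc n)) =
      (Abs_fps (\<lambda>m. of_nat ((m + n) choose n)) :: 'a fps)"
  proof (rule fps_ext)
    fix m
    show "((1 - fps_X) * Abs_fps (\<lambda>m. of_nat ((m + Suc n) choose Suc n))) $ m =
        (Abs_fps (\<lambda>m. of_nat ((m + n) choose n)) :: 'a fps) $ m"
      by (cases m) (simp_all add: algebra_simps binomial_eq_0)
  qed
  then show ?case
    using Suc unfolding power_Suc2[of _ "Suc n"] mult.assoc by (simp only:)
qed

text \<open>The hypothesis is a Cauchy product of \<open>c\<close> with the binomial series, whose
  inverse is the power of 1 - X.\<close>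

lemma worpitzky_imp_generating_function:
  fixes c p :: "nat \<Rightarrow> nat"
  assumes "\<And>m. p m = (\<Sum>k\<le>m. c k * ((m - k + n) choose n))"
  shows "Abs_fps (\<lambda>k. of_nat (c k)) =
    (1 - fps_X) ^ Suc n * (Abs_fps (\<lambda>m. of_nat (p m)) :: 'a::comm_ring_1 fps)"
proof -
  have "Abs_fps (\<lambda>m. of_nat (p m)) =
      Abs_fps (\<lambda>k. of_nat (c k)) * (Abs_fps (\<lambda>m. of_nat ((m + n) choose n)) :: 'a fps)"
    by (rule fps_ext) (simp add: assms fps_mult_nth atMost_atLeast0)
  then have "(1 - fps_X) ^ Suc n * (Abs_fps (\<lambda>m. of_nat (p m)) :: 'a fps) =
      Abs_fps (\<lambda>k. of_nat (c k)) *
        ((1 - fps_X) ^ Suc n * Abs_fps (\<lambda>m. of_nat ((m + n) choose n)))"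
    by (simp only: mult_ac)
  then show ?thesis
    unfolding one_minus_X_power_times_binomial_series by simp
qed

lemma eulerian_series_times_binomial:
  fixes n :: nat
  defines "A \<equiv> Abs_fps (\<lambda>k. of_nat (eulerian n k)) :: rat fps"
    and "B \<equiv> Abs_fps (\<lambda>k. of_nat (eulerianB n k)) :: rat fps"
  shows "A * (1 + fps_X) ^ Suc n =
    (B oo fps_X ^ 2) + fps_const (2 ^ n) * (fps_X * (A oo fps_X ^ 2))"
proof -
  let ?S = "Abs_fps (\<lambda>m. of_nat ((m + 1) ^ n)) :: rat fps"
  let ?T = "Abs_fps (\<lambda>m. of_nat ((2 * m + 1) ^ n)) :: rat fps"
  let ?Q = "(1 - fps_X ^ 2) ^ Suc n :: rat fps"
  have A: "A = (1 - fps_X) ^ Suc n * ?S"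
    unfolding A_def by (rule worpitzky_imp_generating_function) (rule worpitzky_eulerian)
  have B: "B = (1 - fps_X) ^ Suc n * ?T"
    unfolding B_def by (rule worpitzky_imp_generating_function) (rule worpitzky_eulerianB)
  \<comment> \<open>Substituting X^2 for X is multiplicative and additive because X^2 has no
    constant term.\<close>
  have compose: "((1 - fps_X) ^ Suc n * f) oo fps_X ^ 2 = ?Q * (f oo fps_X ^ 2)" for f :: "rat fps"
    by (simp add: fps_compose_mult_distrib fps_compose_power[symmetric] fps_compose_sub_distrib
        del: power_Suc)
  \<comment> \<open>Split by the parity of the exponent: 2j carries (2j+1)^n, a coefficient of
    \<open>?T\<close>, and 2j+1 carries (2j+2)^n = 2^n (j+1)^n, a multiple of a coefficient of
    \<open>?S\<close>.\<close>
  have split: "?S = (?T oo fps_X ^ 2) + fps_const (2 ^ n) * (fps_X * (?S oo fps_X ^ 2))"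
  proof (rule fps_ext)
    fix m :: nat
    show "?S $ m = ((?T oo fps_X ^ 2) + fps_const (2 ^ n) * (fps_X * (?S oo fps_X ^ 2))) $ m"
    proof (cases "even m")
      case True
      then show ?thesis
        by (auto simp: fps_nth_compose_X_power)
    next
      case False
      then obtain j where "m = 2 * j + 1" by (rule oddE)
      moreover have "(2 * j + 1 + 1) ^ n = 2 ^ n * (j + 1) ^ n" for j :: nat
        by (simp flip: power_mult_distrib)
      ultimately show ?thesis
        by (simp add: fps_nth_compose_X_power del: of_nat_power of_nat_Suc of_nat_add)
    qed
  qed
  have "A * (1 + fps_X) ^ Suc n = ((1 - fps_X) * (1 + fps_X)) ^ Suc n * ?S"
    unfolding A power_mult_distrib by (simp only: mult_ac)
  also have "(1 - fps_X) * (1 + fps_X) = (1 - fps_X ^ 2 :: rat fps)"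
    by (simp add: algebra_simps power2_eq_square)
  also have "?Q * ?S = ?Q * (?T oo fps_X ^ 2) +
      fps_const (2 ^ n) * (fps_X * (?Q * (?S oo fps_X ^ 2)))"
    by (subst split) (simp only: distrib_left mult_ac)
  also have "\<dots> = (B oo fps_X ^ 2) + fps_const (2 ^ n) * (fps_X * (A oo fps_X ^ 2))"
    unfolding A B compose ..
  finally show ?thesis .
qed

theorem mainTheorem1:
  fixes n k :: nat
  assumes "n \<ge> 1"
  shows "eulerianB n k = (\<Sum>i=0..2*k. eulerian n i * ((n + 1) choose (2*k - i)))
       \<and> 2 ^ n * eulerian n k = (\<Sum>i=0..2*k+1. eulerian n i * ((n + 1) choose (2*k + 1 - i)))"
proof -
  let ?A = "Abs_fps (\<lambda>k. of_nat (eulerian n k)) :: rat fps"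
  let ?B = "Abs_fps (\<lambda>k. of_nat (eulerianB n k)) :: rat fps"
  \<comment> \<open>At \<open>j = 2*k\<close> only the type B series contributes, and at
    \<open>j = 2*k + 1\<close> only the shifted type A series, so both claims are coefficients of
    one identity. The passage to \<open>rat\<close> is undone by injectivity of
    \<open>of_nat\<close>.\<close>
  have coeff: "(of_nat (\<Sum>i=0..j. eulerian n i * ((n + 1) choose (j - i))) :: rat) =
      ((?B oo fps_X ^ 2) + fps_const (2 ^ n) * (fps_X * (?A oo fps_X ^ 2))) $ j" for j
  proof -
    have "(of_nat (\<Sum>i=0..j. eulerian n i * ((n + 1) choose (j - i))) :: rat) =
        (?A * (1 + fps_X) ^ Suc n) $ j"
      by (simp add: fps_mult_nth fps_binomial_of_nat[symmetric] binomial_gbinomial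
          del: power_Suc of_nat_Suc)
    then show ?thesis by (simp only: eulerian_series_times_binomial)
  qed
  have "(of_nat (eulerianB n k) :: rat) =
      of_nat (\<Sum>i=0..2*k. eulerian n i * ((n + 1) choose (2*k - i)))"
    unfolding coeff by (simp add: fps_nth_compose_X_power)
  moreover have "(of_nat (2 ^ n * eulerian n k) :: rat) =
      of_nat (\<Sum>i=0..2*k+1. eulerian n i * ((n + 1) choose (2*k + 1 - i)))"
    unfolding coeff by (simp add: fps_nth_compose_X_power)
  ultimately show ?thesis
    unfolding of_nat_eq_iff by blast
qed

end
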